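(* The category $\mathbf{GenTop}$ of generalized topological spaces and continuous maps, with its underlying set functor $U:\mathbf{GenTop}\to\mathbf{Set}$, is a topological category over $\mathbf{Set}$. That is, $U$ is faithful, amnestic and fibre-small, and all initial lifts (weak structures) exist, or equivalently all final lifts (strong structures) exist. Hence in $\mathbf{GenTop}$ all (small) diagrams have both limits and colimits, and these can be obtained from the limits, respectively colimits, of the respective underlying diagrams in $\mathbf{Set}$ by initial lifts, respectively final lifts (along the limit projections, respectively the colimit injections).
   Context: A generalized topology (GT) on a set $X$ (possibly empty) is a family $\mu\subset P(X)$ with $\emptyset\in\mu$ that is closed under arbitrary unions; $(X,\mu)$ is then a generalized topological space (GTS). A map $f:(X,\mu)\to(Y,\nu)$ is continuous if $f^{-1}(N)\in\mu$ for all $N\in\nu$. $\mathbf{GenTop}$ is the category of all GTS's and continuous maps, $\mathbf{Set}$ that of sets and functions, and $U$ sends $(X,\mu)$ to $X$ and a continuous map to its underlying function. $U$ is faithful if distinct morphisms with the same domain and the same codomain have distinct images under $U$. $U$ is amnestic if, whenever the identity of $X$ is continuous both as $(X,\mu)\to(X,\nu)$ and as $(X,\nu)\to(X,\mu)$, then $\mu=\nu$. $U$ is fibre-small if every set $X$ underlies only a set of GTS's. Initial lift (weak structure): given a set $X$ and an indexed family (indexed by a set or class $J$) of functions $\varphi_\alpha:X\to Y_\alpha$, where each $(Y_\alpha,\nu_\alpha)$ is a GTS, an initial lift is a GT $\mu$ on $X$ such that each $\varphi_\alpha:(X,\mu)\to(Y_\alpha,\nu_\alpha)$ is continuous and, for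 every GTS $(Z,\varrho)$ and every function $h:Z\to X$ such that all $\varphi_\alpha h:(Z,\varrho)\to(Y_\alpha,\nu_\alpha)$ are continuous, $h:(Z,\varrho)\to(X,\mu)$ is continuous. Final lift (strong structure): given a set $X$ and an indexed family (set or class) of functions $\psi_\alpha:Y_\alpha\to X$, where each $(Y_\alpha,\nu_\alpha)$ is a GTS, a final lift is a GT $\mu$ on $X$ such that each $\psi_\alpha:(Y_\alpha,\nu_\alpha)\to(X,\mu)$ is continuous and, for every GTS $(Z,\varrho)$ and every function $h:X\to Z$ such that all $h\psi_\alpha:(Y_\alpha,\nu_\alpha)\to(Z,\varrho)$ are continuous, $h:(X,\mu)\to(Z,\varrho)$ is continuous. *)

theory Defs
  imports Main "HOL-Library.FuncSet"
begin

section \<open>A universe of sets\<close>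

text \<open>
  HOL does not prove that any type with infinite sets is closed under the set constructions
  needed for limits and colimits, so the category of sets is taken relative to an arbitrary universe: a type whose
  elements \<open>x\<close> are sets with extension \<open>elts x\<close>, subject to the ZF axioms of extensionality,
  separation, union, power set and replacement, the schemes being second-order. Subsets of the
  type play the role of classes, and those in \<open>range elts\<close> are the classes that are sets.
  Infinity and foundation are not required, so every (second-order) model of ZFC is an
  instance; choice is inherited from HOL. Empty set and pairing follow from the axioms below.
\<close>

class set_universe =
  fixes elts :: "'a \<Rightarrow> 'a set"
  assumes elts_eqD: "elts x = elts y \<Longrightarrow> x = y"
    and elts_separation: "A \<subseteq> elts x \<Longrightarrow> A \<in> range elts"
    and elts_Union: "\<Union> (elts ` elts x) \<in> range elts"
    and elts_Pow: "{y. elts y \<subseteq> elts x} \<in> range elts"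
    and elts_replacement: "g ` elts x \<in> range elts"


section \<open>Categories, functors, limits and colimits\<close>

record ('o, 'm) cat =
  obj :: "'o set"
  arr :: "'m set"
  src :: "'m \<Rightarrow> 'o"
  tgt :: "'m \<Rightarrow> 'o"
  idt :: "'o \<Rightarrow> 'm"
  cmp :: "'m \<Rightarrow> 'm \<Rightarrow> 'm"  \<comment> \<open>\<open>cmp C g f\<close> is \<open>g\<close> after \<open>f\<close>\<close>

definition hom :: "('o, 'm) cat \<Rightarrow> 'o \<Rightarrow> 'o \<Rightarrow> 'm set" where
  "hom C x y = {f \<in> arr C. src C f = x \<and> tgt C f = y}"

definition is_category :: "('o, 'm) cat \<Rightarrow> bool" where
  "is_category C \<longleftrightarrow>
     (\<forall>f\<in>arr C. src C f \<in> obj C \<and> tgt C f \<in> obj C) \<and>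
     (\<forall>x\<in>obj C. idt C x \<in> hom C x x) \<and>
     (\<forall>f\<in>arr C. \<forall>g\<in>arr C. tgt C f = src C g \<longrightarrow> cmp C g f \<in> hom C (src C f) (tgt C g)) \<and>
     (\<forall>f\<in>arr C. cmp C f (idt C (src C f)) = f \<and> cmp C (idt C (tgt C f)) f = f) \<and>
     (\<forall>f\<in>arr C. \<forall>g\<in>arr C. \<forall>h\<in>arr C. tgt C f = src C g \<longrightarrow> tgt C g = src C h \<longrightarrow>
        cmp C h (cmp C g f) = cmp C (cmp C h g) f)"

definition is_functor ::
  "('o, 'm) cat \<Rightarrow> ('p, 'n) cat \<Rightarrow> ('o \<Rightarrow> 'p) \<Rightarrow> ('m \<Rightarrow> 'n) \<Rightarrow> bool" where
  "is_functor C D Fo Fa \<longleftrightarrow>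
     is_category C \<and> is_category D \<and>
     (\<forall>x\<in>obj C. Fo x \<in> obj D) \<and>
     (\<forall>f\<in>arr C. Fa f \<in> hom D (Fo (src C f)) (Fo (tgt C f))) \<and>
     (\<forall>x\<in>obj C. Fa (idt C x) = idt D (Fo x)) \<and>
     (\<forall>f\<in>arr C. \<forall>g\<in>arr C. tgt C f = src C g \<longrightarrow> Fa (cmp C g f) = cmp D (Fa g) (Fa f))"

definition faithful :: "('o, 'm) cat \<Rightarrow> ('m \<Rightarrow> 'n) \<Rightarrow> bool" where
  "faithful C Fa \<longleftrightarrow> (\<forall>x\<in>obj C. \<forall>y\<in>obj C. inj_on Fa (hom C x y))"

definition small_category :: "('v::set_universe, 'v) cat \<Rightarrow> bool" where
  "small_category J \<longleftrightarrow> is_category J \<and> obj J \<in> range elts \<and> arr J \<in> range elts"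

definition small_diagram ::
  "('v::set_universe, 'v) cat \<Rightarrow> ('o, 'm) cat \<Rightarrow> ('v \<Rightarrow> 'o) \<Rightarrow> ('v \<Rightarrow> 'm) \<Rightarrow> bool" where
  "small_diagram J C Do Da \<longleftrightarrow> small_category J \<and> is_functor J C Do Da"

definition is_cone ::
  "('i, 'k) cat \<Rightarrow> ('o, 'm) cat \<Rightarrow> ('i \<Rightarrow> 'o) \<Rightarrow> ('k \<Rightarrow> 'm) \<Rightarrow> 'o \<Rightarrow> ('i \<Rightarrow> 'm) \<Rightarrow> bool" where
  "is_cone J C Do Da L p \<longleftrightarrow>
     L \<in> obj C \<and>
     (\<forall>j\<in>obj J. p j \<in> hom C L (Do j)) \<and>
     (\<forall>a\<in>arr J. cmp C (Da a) (p (src J a)) = p (tgt J a))"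

definition is_limit ::
  "('i, 'k) cat \<Rightarrow> ('o, 'm) cat \<Rightarrow> ('i \<Rightarrow> 'o) \<Rightarrow> ('k \<Rightarrow> 'm) \<Rightarrow> 'o \<Rightarrow> ('i \<Rightarrow> 'm) \<Rightarrow> bool" where
  "is_limit J C Do Da L p \<longleftrightarrow>
     is_cone J C Do Da L p \<and>
     (\<forall>Z q. is_cone J C Do Da Z q \<longrightarrow>
        (\<exists>!h. h \<in> hom C Z L \<and> (\<forall>j\<in>obj J. cmp C (p j) h = q j)))"

definition is_cocone ::
  "('i, 'k) cat \<Rightarrow> ('o, 'm) cat \<Rightarrow> ('i \<Rightarrow> 'o) \<Rightarrow> ('k \<Rightarrow> 'm) \<Rightarrow> 'o \<Rightarrow> ('i \<Rightarrow> 'm) \<Rightarrow> bool" where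
  "is_cocone J C Do Da L p \<longleftrightarrow>
     L \<in> obj C \<and>
     (\<forall>j\<in>obj J. p j \<in> hom C (Do j) L) \<and>
     (\<forall>a\<in>arr J. cmp C (p (tgt J a)) (Da a) = p (src J a))"

definition is_colimit ::
  "('i, 'k) cat \<Rightarrow> ('o, 'm) cat \<Rightarrow> ('i \<Rightarrow> 'o) \<Rightarrow> ('k \<Rightarrow> 'm) \<Rightarrow> 'o \<Rightarrow> ('i \<Rightarrow> 'm) \<Rightarrow> bool" where
  "is_colimit J C Do Da L p \<longleftrightarrow>
     is_cocone J C Do Da L p \<and>
     (\<forall>Z q. is_cocone J C Do Da Z q \<longrightarrow>
        (\<exists>!h. h \<in> hom C L Z \<and> (\<forall>j\<in>obj J. cmp C h (p j) = q j)))"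


section \<open>Generalized topological spaces\<close>

definition gen_topology :: "'a set \<Rightarrow> 'a set set \<Rightarrow> bool" where
  "gen_topology X T \<longleftrightarrow> T \<subseteq> Pow X \<and> {} \<in> T \<and> (\<forall>S. S \<subseteq> T \<longrightarrow> \<Union> S \<in> T)"

definition gen_continuous ::
  "'a set \<Rightarrow> 'a set set \<Rightarrow> 'b set \<Rightarrow> 'b set set \<Rightarrow> ('a \<Rightarrow> 'b) \<Rightarrow> bool" where
  "gen_continuous X S Y T f \<longleftrightarrow> f \<in> X \<rightarrow> Y \<and> (\<forall>N\<in>T. f -` N \<inter> X \<in> S)"

text \<open>
  A GTS is a pair \<open>(X, \<mu>)\<close> of elements of the universe. The members of \<open>\<mu>\<close> are again elements
  of the universe, so the family of subsets they denote is \<open>elts ` elts \<mu>\<close>.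
\<close>

definition opens :: "'v::set_universe \<Rightarrow> 'v set set" where
  "opens \<mu> = elts ` elts \<mu>"

definition is_gts :: "'v::set_universe \<times> 'v \<Rightarrow> bool" where
  "is_gts P \<longleftrightarrow> gen_topology (elts (fst P)) (opens (snd P))"

definition continuous_gts ::
  "'v::set_universe \<times> 'v \<Rightarrow> 'v \<times> 'v \<Rightarrow> ('v \<Rightarrow> 'v) \<Rightarrow> bool" where
  "continuous_gts P Q f \<longleftrightarrow>
     gen_continuous (elts (fst P)) (opens (snd P)) (elts (fst Q)) (opens (snd Q)) f"


section \<open>The categories of sets and of generalized topological spaces\<close>

text \<open>
  An arrow is a triple of domain, function and codomain, where the function is \<open>undefined\<close>
  outside its domain so that equality of arrows is equality of maps.
\<close>

type_synonym 'v set_arr = "'v \<times> ('v \<Rightarrow> 'v) \<times> 'v"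
type_synonym 'v gts_arr = "('v \<times> 'v) \<times> ('v \<Rightarrow> 'v) \<times> ('v \<times> 'v)"

abbreviation arr_fun :: "'o \<times> ('v \<Rightarrow> 'v) \<times> 'o \<Rightarrow> 'v \<Rightarrow> 'v" where
  "arr_fun a \<equiv> fst (snd a)"

definition SetCat :: "('v::set_universe, 'v set_arr) cat" where
  "SetCat = \<lparr>
     obj = UNIV,
     arr = {(X, f, Y). f \<in> elts X \<rightarrow>\<^sub>E elts Y},
     src = (\<lambda>(X, f, Y). X),
     tgt = (\<lambda>(X, f, Y). Y),
     idt = (\<lambda>X. (X, restrict id (elts X), X)),
     cmp = (\<lambda>(Y, g, Z) (X, f, Y'). (X, compose (elts X) g f, Z)) \<rparr>"

definition GenTop :: "('v::set_universe \<times> 'v, 'v gts_arr) cat" where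
  "GenTop = \<lparr>
     obj = {P. is_gts P},
     arr = {(P, f, Q). is_gts P \<and> is_gts Q \<and> f \<in> extensional (elts (fst P)) \<and>
                       continuous_gts P Q f},
     src = (\<lambda>(P, f, Q). P),
     tgt = (\<lambda>(P, f, Q). Q),
     idt = (\<lambda>P. (P, restrict id (elts (fst P)), P)),
     cmp = (\<lambda>(Q, g, R) (P, f, Q'). (P, compose (elts (fst P)) g f, R)) \<rparr>"

definition U_obj :: "'v::set_universe \<times> 'v \<Rightarrow> 'v" where
  "U_obj P = fst P"

definition U_arr :: "'v::set_universe gts_arr \<Rightarrow> 'v set_arr" where
  "U_arr = (\<lambda>(P, f, Q). (U_obj P, f, U_obj Q))"


section \<open>Initial and final lifts\<close>

text \<open>
  The index class \<open>J\<close> is an arbitrary subset of the index type and need not be a set of the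
  universe; only the values of \<open>\<phi> \<alpha>\<close> on \<open>X\<close> (respectively of \<open>\<psi> \<alpha>\<close> on \<open>Y \<alpha>\<close>) matter.
\<close>

definition initial_lift ::
  "'v::set_universe \<Rightarrow> 'j set \<Rightarrow> ('j \<Rightarrow> 'v \<times> 'v) \<Rightarrow> ('j \<Rightarrow> 'v \<Rightarrow> 'v) \<Rightarrow> 'v \<Rightarrow> bool" where
  "initial_lift X J Y \<phi> \<mu> \<longleftrightarrow>
     is_gts (X, \<mu>) \<and>
     (\<forall>\<alpha>\<in>J. continuous_gts (X, \<mu>) (Y \<alpha>) (\<phi> \<alpha>)) \<and>
     (\<forall>Z h. is_gts Z \<longrightarrow> h \<in> elts (fst Z) \<rightarrow> elts X \<longrightarrow>
        (\<forall>\<alpha>\<in>J. continuous_gts Z (Y \<alpha>) (\<phi> \<alpha> \<circ> h)) \<longrightarrow> continuous_gts Z (X, \<mu>) h)"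

definition final_lift ::
  "'v::set_universe \<Rightarrow> 'j set \<Rightarrow> ('j \<Rightarrow> 'v \<times> 'v) \<Rightarrow> ('j \<Rightarrow> 'v \<Rightarrow> 'v) \<Rightarrow> 'v \<Rightarrow> bool" where
  "final_lift X J Y \<psi> \<mu> \<longleftrightarrow>
     is_gts (X, \<mu>) \<and>
     (\<forall>\<alpha>\<in>J. continuous_gts (Y \<alpha>) (X, \<mu>) (\<psi> \<alpha>)) \<and>
     (\<forall>Z h. is_gts Z \<longrightarrow> h \<in> elts X \<rightarrow> elts (fst Z) \<longrightarrow>
        (\<forall>\<alpha>\<in>J. continuous_gts (Y \<alpha>) Z (h \<circ> \<psi> \<alpha>)) \<longrightarrow> continuous_gts (X, \<mu>) Z h)"

end

theory Submission
  imports Defs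
begin

text \<open>
  A generalized topology is constrained only by unions, and preimages preserve unions. Hence the
  unions of the preimages of open sets form an initial structure (\<open>initial_lift_exists\<close>), and
  the sets whose preimages are all open form a final one (\<open>final_lift_exists\<close>). Both are families
  of subsets of \<open>X\<close>, however large the class of given maps is, so they are always
  represented by an element of the universe; for the same reason the fibre over \<open>X\<close> is a set.
  Amnesticity says that two topologies each containing the other are equal.

  Limits and colimits then come from those of sets. The cone on a limit in the category of sets,
  equipped with the initial structure, is a cone of continuous maps; a competing cone of continuous
  maps has a unique mediating function, which is continuous by the universal property of the
  initial structure. Every equation between continuous maps needed along the way can be checked on
  underlying functions, as \<open>U\<close> is faithful (\<open>initial_lift_is_limit\<close>, and dually
  \<open>final_lift_is_colimit\<close>).

  What remains is that the category of sets of the universe has limits and colimits of small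
  diagrams (\<open>SetCat_limit_exists\<close>, \<open>SetCat_colimit_exists\<close>). The usual constructions
  consist of functions and of equivalence classes of pairs; these must be coded by elements of
  the universe, injectively and so that the codes form a set. Kuratowski pairs, graphs, power sets and
  replacement provide such codes.
\<close>

section \<open>Small classes\<close>

definition small :: "'v::set_universe set \<Rightarrow> bool" where
  "small A \<longleftrightarrow> A \<in> range elts"

abbreviation vset :: "'v::set_universe set \<Rightarrow> 'v" where
  "vset \<equiv> inv elts"

lemma small_elts [simp]: "small (elts x)"
  by (simp add: small_def)

lemma elts_vset [simp]: "small A \<Longrightarrow> elts (vset A) = A"
  unfolding small_def by (rule f_inv_into_f)

lemma elts_eq_iff [simp]: "elts x = elts y \<longleftrightarrow> x = y"
  using elts_eqD by blast

lemma vset_eq_iff: "small A \<Longrightarrow> small B \<Longrightarrow> vset A = vset B \<longleftrightarrow> A = B"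
  by (metis elts_vset)

lemma small_subset:
  assumes "small B" "A \<subseteq> B"
  shows "small A"
  using assms elts_separation by (auto simp: small_def)

lemma small_image:
  fixes f :: "'v::set_universe \<Rightarrow> 'v"
  shows "small A \<Longrightarrow> small (f ` A)"
  using elts_replacement[of f "vset A"] by (simp add: small_def[symmetric])

lemma small_Union:
  fixes A :: "'v::set_universe set" and B :: "'v \<Rightarrow> 'v set"
  assumes "small A" "\<And>x. x \<in> A \<Longrightarrow> small (B x)"
  shows "small (\<Union>x\<in>A. B x)"
proof -
  let ?F = "vset ((\<lambda>x. vset (B x)) ` A)"
  have "small (\<Union> (elts ` elts ?F))"
    using elts_Union unfolding small_def by blast
  also have "elts ` elts ?F = B ` A"
    using assms by (simp add: small_image image_image cong: image_cong_simp)
  finally show ?thesis .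
qed

lemma small_powerset:
  assumes "small A"
  shows "small {y. elts y \<subseteq> A}"
  using elts_Pow[of "vset A"] assms by (simp add: small_def[symmetric])

text \<open>The two elements of the iterated power set of the empty set can be replaced by any two
  given elements, which is how pairing follows from replacement.\<close>

lemma small_doubleton: "small {a, b}"
proof -
  define z :: 'a where "z = vset {}"
  define u where "u = vset {z}"
  have "small ({} :: 'a set)"
    by (rule small_subset[OF small_elts]) simp
  then have z: "elts z = {}"
    by (simp add: z_def)
  have "{y. elts y \<subseteq> elts z} = {z}"
    using z by (auto intro: elts_eqD)
  with small_powerset[of "elts z"] have "small {z}"
    by simp
  then have u: "elts u = {z}"
    by (simp add: u_def)
  then have "u \<noteq> z"
    using z by auto
  have "small {y. elts y \<subseteq> elts u}"
    by (rule small_powerset) simp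
  then have "small ((\<lambda>y. if y = z then a else b) ` {z, u})"
    by (rule small_image[OF small_subset]) (auto simp: z u)
  then show ?thesis
    using \<open>u \<noteq> z\<close> by (simp add: insert_commute)
qed

text \<open>The Kuratowski pair, with its singleton written as a doubleton so that
  \<open>small_doubleton\<close> applies to both of its members.\<close>

definition kpair :: "'v::set_universe \<Rightarrow> 'v \<Rightarrow> 'v" where
  "kpair a b = vset {vset {a, a}, vset {a, b}}"

lemma kpair_eq_iff [simp]: "kpair a b = kpair c d \<longleftrightarrow> a = c \<and> b = d"
  unfolding kpair_def
  by (simp only: vset_eq_iff small_doubleton doubleton_eq_iff) auto

lemma small_Sigma_code:
  fixes A :: "'v::set_universe set"
  assumes "small A" "\<And>x. x \<in> A \<Longrightarrow> small (B x)"
  shows "small (case_prod kpair ` Sigma A B)"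
proof -
  have "case_prod kpair ` Sigma A B = (\<Union>x\<in>A. kpair x ` B x)"
    by force
  then show ?thesis
    using assms by (simp add: small_Union small_image)
qed

text \<open>The subsets of any collection that can be coded by the members of a set can again be so
  coded. This yields codes for functions, as graphs, and for equivalence classes.\<close>

lemma small_Pow_code:
  fixes e :: "'b \<Rightarrow> 'v::set_universe"
  assumes "inj_on e M" "small (e ` M)"
  shows "inj_on (\<lambda>A. vset (e ` A)) (Pow M) \<and> small ((\<lambda>A. vset (e ` A)) ` Pow M)"
proof
  have sm: "small (e ` A)" if "A \<subseteq> M" for A
    using assms(2) by (rule small_subset) (use that in auto)
  show "inj_on (\<lambda>A. vset (e ` A)) (Pow M)"
  proof (rule inj_onI)
    fix A B assume AB: "A \<in> Pow M" "B \<in> Pow M" "vset (e ` A) = vset (e ` B)"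
    then have "e ` A = e ` B"
      by (simp add: vset_eq_iff sm)
    then show "A = B"
      using AB(1,2) inj_on_image_eq_iff[OF assms(1), of A B] by simp
  qed
  have "(\<lambda>A. vset (e ` A)) ` Pow M \<subseteq> {y. elts y \<subseteq> e ` M}"
  proof (rule image_subsetI)
    fix A assume "A \<in> Pow M"
    then show "vset (e ` A) \<in> {y. elts y \<subseteq> e ` M}"
      by (simp add: sm image_mono)
  qed
  then show "small ((\<lambda>A. vset (e ` A)) ` Pow M)"
    by (rule small_subset[OF small_powerset[OF assms(2)]])
qed

lemma small_PiE_code:
  fixes A :: "'v::set_universe set" and B :: "'v \<Rightarrow> 'v set"
  assumes "small A" "\<And>x. x \<in> A \<Longrightarrow> small (B x)"
  obtains e :: "('v \<Rightarrow> 'v) \<Rightarrow> 'v" where "inj_on e (Pi\<^sub>E A B)" "small (e ` Pi\<^sub>E A B)"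
proof
  \<comment> \<open>A function is first replaced by its graph, and the graph by the set of codes of its pairs.\<close>
  let ?c = "\<lambda>G. vset (case_prod kpair ` G)"
  let ?gr = "\<lambda>s. (\<lambda>x. (x, s x)) ` A"
  have "inj_on (case_prod kpair) (Sigma A B)"
    by (auto simp: inj_on_def)
  then have c: "inj_on ?c (Pow (Sigma A B))" "small (?c ` Pow (Sigma A B))"
    using small_Pow_code[OF _ small_Sigma_code[OF assms]] by simp_all
  have gr: "?gr s \<in> Pow (Sigma A B)" if "s \<in> Pi\<^sub>E A B" for s
    using that by auto
  have "inj_on ?gr (Pi\<^sub>E A B)"
  proof (rule inj_onI)
    fix s t assume st: "s \<in> Pi\<^sub>E A B" "t \<in> Pi\<^sub>E A B" "?gr s = ?gr t"
    show "s = t"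
      by (rule PiE_ext[OF st(1,2)]) (use st(3) in auto)
  qed
  then show "inj_on (?c \<circ> ?gr) (Pi\<^sub>E A B)"
    by (rule comp_inj_on) (rule inj_on_subset[OF c(1)], use gr in blast)
  show "small ((?c \<circ> ?gr) ` Pi\<^sub>E A B)"
    unfolding image_comp[symmetric] by (rule small_subset[OF c(2)]) (use gr in blast)
qed


section \<open>Generalized topologies as elements of the universe\<close>

lemma opens_eq_iff: "opens \<mu> = opens \<nu> \<longleftrightarrow> \<mu> = \<nu>"
  unfolding opens_def by (metis elts_eq_iff injI inj_image_eq_iff)

lemma obtain_opens:
  fixes X :: "'v::set_universe"
  assumes "T \<subseteq> Pow (elts X)"
  obtains \<mu> where "opens \<mu> = T"
proof
  have "small {y. elts y \<in> T}"
    by (rule small_subset[OF small_powerset[OF small_elts[of X]]]) (use assms in auto)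
  moreover have "\<exists>y. A = elts y" if "A \<in> T" for A
  proof -
    have "small A"
      by (rule small_subset[OF small_elts[of X]]) (use that assms in auto)
    then show ?thesis
      by (metis elts_vset)
  qed
  ultimately show "opens (vset {y. elts y \<in> T}) = T"
    by (auto simp: opens_def)
qed

lemma small_fibre: "small {\<mu>. is_gts (X, \<mu>)}"
proof (rule small_subset)
  show "small {\<mu>. elts \<mu> \<subseteq> {y. elts y \<subseteq> elts X}}"
    by (intro small_powerset small_elts)
  have "opens \<mu> \<subseteq> Pow (elts X)" if "is_gts (X, \<mu>)" for \<mu>
    using that by (simp add: is_gts_def gen_topology_def)
  then show "{\<mu>. is_gts (X, \<mu>)} \<subseteq> {\<mu>. elts \<mu> \<subseteq> {y. elts y \<subseteq> elts X}}"
    unfolding opens_def by blast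
qed

lemma is_gts_iff:
  "is_gts P \<longleftrightarrow> opens (snd P) \<subseteq> Pow (elts (fst P)) \<and> {} \<in> opens (snd P) \<and>
     (\<forall>S. S \<subseteq> opens (snd P) \<longrightarrow> \<Union> S \<in> opens (snd P))"
  by (simp add: is_gts_def gen_topology_def)

lemma continuous_gts_iff:
  "continuous_gts P Q f \<longleftrightarrow> f \<in> elts (fst P) \<rightarrow> elts (fst Q) \<and>
     (\<forall>N\<in>opens (snd Q). f -` N \<inter> elts (fst P) \<in> opens (snd P))"
  by (simp add: continuous_gts_def gen_continuous_def)

lemma continuous_gts_cong:
  assumes "\<And>x. x \<in> elts (fst P) \<Longrightarrow> f x = g x"
  shows "continuous_gts P Q f \<longleftrightarrow> continuous_gts P Q g"
proof -
  have "f -` N \<inter> elts (fst P) = g -` N \<inter> elts (fst P)" for N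
    using assms by auto
  moreover have "f \<in> elts (fst P) \<rightarrow> elts (fst Q) \<longleftrightarrow> g \<in> elts (fst P) \<rightarrow> elts (fst Q)"
    using assms by (intro Pi_cong) auto
  ultimately show ?thesis
    by (simp add: continuous_gts_iff)
qed

lemma continuous_gts_id: "is_gts P \<Longrightarrow> continuous_gts P P id"
  by (auto simp: continuous_gts_iff is_gts_iff Int_absorb2 subset_iff)

lemma continuous_gts_comp:
  assumes f: "continuous_gts P Q f" and g: "continuous_gts Q R g"
  shows "continuous_gts P R (g \<circ> f)"
  unfolding continuous_gts_iff
proof (intro conjI ballI)
  show "g \<circ> f \<in> elts (fst P) \<rightarrow> elts (fst R)"
    using f g by (auto simp: continuous_gts_iff)
  fix N assume "N \<in> opens (snd R)"
  then have "f -` (g -` N \<inter> elts (fst Q)) \<inter> elts (fst P) \<in> opens (snd P)"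
    using f g by (simp add: continuous_gts_iff del: vimage_Int)
  also have "f -` (g -` N \<inter> elts (fst Q)) \<inter> elts (fst P) = (g \<circ> f) -` N \<inter> elts (fst P)"
    using f by (auto simp: continuous_gts_iff)
  finally show "(g \<circ> f) -` N \<inter> elts (fst P) \<in> opens (snd P)" .
qed

lemma opens_subset_if_id_continuous:
  assumes "is_gts (X, \<nu>)" "continuous_gts (X, \<mu>) (X, \<nu>) id"
  shows "opens \<nu> \<subseteq> opens \<mu>"
proof
  fix N assume "N \<in> opens \<nu>"
  then have "N \<inter> elts X \<in> opens \<mu>" "N \<subseteq> elts X"
    using assms by (auto simp: continuous_gts_iff is_gts_iff)
  then show "N \<in> opens \<mu>"
    by (simp add: Int_absorb2)
qed


section \<open>Initial and final lifts\<close>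

text \<open>The preimages of open sets must be open; since a generalized topology need only be closed
  under unions, their unions already form the smallest generalized topology containing them.
  Preimages commute with unions, so it suffices to test continuity into it on the preimages
  themselves, which is the universal property.\<close>

lemma initial_lift_exists:
  fixes X :: "'v::set_universe"
  assumes Y: "\<And>\<alpha>. \<alpha> \<in> J \<Longrightarrow> is_gts (Y \<alpha>)"
    and \<phi>: "\<And>\<alpha>. \<alpha> \<in> J \<Longrightarrow> \<phi> \<alpha> \<in> elts X \<rightarrow> elts (fst (Y \<alpha>))"
  shows "\<exists>\<mu>. initial_lift X J Y \<phi> \<mu>"
proof -
  define B where "B = (\<Union>\<alpha>\<in>J. (\<lambda>N. \<phi> \<alpha> -` N \<inter> elts X) ` opens (snd (Y \<alpha>)))"
  define T where "T = \<Union> ` Pow B"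
  have "T \<subseteq> Pow (elts X)"
    by (auto simp: T_def B_def)
  then obtain \<mu> where \<mu>: "opens \<mu> = T"
    by (rule obtain_opens)
  have BT: "B \<subseteq> T"
  proof
    fix b assume "b \<in> B"
    then show "b \<in> T"
      unfolding T_def by (intro image_eqI[of _ _ "{b}"]) auto
  qed
  have union: "\<Union> S \<in> T" if "S \<subseteq> T" for S
  proof -
    have "\<exists>C. C \<subseteq> Pow B \<and> S = \<Union> ` C"
      using that unfolding T_def by (simp add: subset_image_iff)
    then obtain C where "C \<subseteq> Pow B" "S = \<Union> ` C"
      by blast
    then have "\<Union> S = \<Union> (\<Union> C)" "\<Union> C \<in> Pow B"
      by auto
    then show ?thesis
      unfolding T_def by (metis imageI)
  qed
  have gts: "is_gts (X, \<mu>)"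
    using \<open>T \<subseteq> Pow (elts X)\<close> union[of "{}"] union by (simp add: is_gts_iff \<mu>)
  have "continuous_gts (X, \<mu>) (Y \<alpha>) (\<phi> \<alpha>)" if "\<alpha> \<in> J" for \<alpha>
    using \<phi>[OF that] BT that by (auto simp: continuous_gts_iff \<mu> B_def)
  moreover have "continuous_gts Z (X, \<mu>) h"
    if Z: "is_gts Z" and h: "h \<in> elts (fst Z) \<rightarrow> elts X"
      and c: "\<And>\<alpha>. \<alpha> \<in> J \<Longrightarrow> continuous_gts Z (Y \<alpha>) (\<phi> \<alpha> \<circ> h)" for Z h
    unfolding continuous_gts_iff
  proof (intro conjI ballI)
    show "h \<in> elts (fst Z) \<rightarrow> elts (fst (X, \<mu>))"
      using h by simp
    have B: "h -` b \<inter> elts (fst Z) \<in> opens (snd Z)" if "b \<in> B" for b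
    proof -
      obtain \<alpha> N where \<alpha>: "\<alpha> \<in> J" "N \<in> opens (snd (Y \<alpha>))" "b = \<phi> \<alpha> -` N \<inter> elts X"
        using \<open>b \<in> B\<close> by (auto simp: B_def)
      then have "(\<phi> \<alpha> \<circ> h) -` N \<inter> elts (fst Z) \<in> opens (snd Z)"
        using c by (simp add: continuous_gts_iff)
      also have "(\<phi> \<alpha> \<circ> h) -` N \<inter> elts (fst Z) = h -` b \<inter> elts (fst Z)"
        using h \<alpha>(3) by auto
      finally show ?thesis .
    qed
    fix N assume "N \<in> opens (snd (X, \<mu>))"
    then obtain S where S: "S \<subseteq> B" "N = \<Union> S"
      by (auto simp: \<mu> T_def)
    have "(\<lambda>b. h -` b \<inter> elts (fst Z)) ` S \<subseteq> opens (snd Z)"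
      using B S(1) by auto
    then have "\<Union> ((\<lambda>b. h -` b \<inter> elts (fst Z)) ` S) \<in> opens (snd Z)"
      using Z unfolding is_gts_iff by metis
    also have "\<Union> ((\<lambda>b. h -` b \<inter> elts (fst Z)) ` S) = h -` N \<inter> elts (fst Z)"
      using S(2) by auto
    finally show "h -` N \<inter> elts (fst Z) \<in> opens (snd Z)" .
  qed
  ultimately show ?thesis
    using gts by (auto simp: initial_lift_def)
qed

text \<open>The final lift is the largest family making all given maps continuous; it is closed under
  unions because preimages commute with them.\<close>

lemma final_lift_exists:
  fixes X :: "'v::set_universe"
  assumes Y: "\<And>\<alpha>. \<alpha> \<in> J \<Longrightarrow> is_gts (Y \<alpha>)"
    and \<psi>: "\<And>\<alpha>. \<alpha> \<in> J \<Longrightarrow> \<psi> \<alpha> \<in> elts (fst (Y \<alpha>)) \<rightarrow> elts X"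
  shows "\<exists>\<mu>. final_lift X J Y \<psi> \<mu>"
proof -
  define T where
    "T = {N \<in> Pow (elts X). \<forall>\<alpha>\<in>J. \<psi> \<alpha> -` N \<inter> elts (fst (Y \<alpha>)) \<in> opens (snd (Y \<alpha>))}"
  have "T \<subseteq> Pow (elts X)"
    by (auto simp: T_def)
  then obtain \<mu> where \<mu>: "opens \<mu> = T"
    by (rule obtain_opens)
  have union: "\<Union> S \<in> T" if "S \<subseteq> T" for S
  proof -
    have "\<psi> \<alpha> -` \<Union> S \<inter> elts (fst (Y \<alpha>)) \<in> opens (snd (Y \<alpha>))" if "\<alpha> \<in> J" for \<alpha>
    proof -
      have "(\<lambda>N. \<psi> \<alpha> -` N \<inter> elts (fst (Y \<alpha>))) ` S \<subseteq> opens (snd (Y \<alpha>))"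
        using \<open>S \<subseteq> T\<close> that by (auto simp: T_def)
      then have "\<Union> ((\<lambda>N. \<psi> \<alpha> -` N \<inter> elts (fst (Y \<alpha>))) ` S) \<in> opens (snd (Y \<alpha>))"
        using Y[OF that] unfolding is_gts_iff by metis
      also have "\<Union> ((\<lambda>N. \<psi> \<alpha> -` N \<inter> elts (fst (Y \<alpha>))) ` S)
          = \<psi> \<alpha> -` \<Union> S \<inter> elts (fst (Y \<alpha>))"
        by auto
      finally show ?thesis .
    qed
    then show ?thesis
      using that by (auto simp: T_def)
  qed
  have gts: "is_gts (X, \<mu>)"
    using \<open>T \<subseteq> Pow (elts X)\<close> union[of "{}"] union by (simp add: is_gts_iff \<mu>)
  have "continuous_gts (Y \<alpha>) (X, \<mu>) (\<psi> \<alpha>)" if "\<alpha> \<in> J" for \<alpha>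
    using \<psi>[OF that] that by (auto simp: continuous_gts_iff \<mu> T_def)
  moreover have "continuous_gts (X, \<mu>) Z h"
    if h: "h \<in> elts X \<rightarrow> elts (fst Z)"
      and c: "\<And>\<alpha>. \<alpha> \<in> J \<Longrightarrow> continuous_gts (Y \<alpha>) Z (h \<circ> \<psi> \<alpha>)" for Z h
    unfolding continuous_gts_iff
  proof (intro conjI ballI)
    show "h \<in> elts (fst (X, \<mu>)) \<rightarrow> elts (fst Z)"
      using h by simp
    fix N assume N: "N \<in> opens (snd Z)"
    have "\<psi> \<alpha> -` (h -` N \<inter> elts X) \<inter> elts (fst (Y \<alpha>)) \<in> opens (snd (Y \<alpha>))"
      if "\<alpha> \<in> J" for \<alpha>
    proof -
      have "(h \<circ> \<psi> \<alpha>) -` N \<inter> elts (fst (Y \<alpha>)) \<in> opens (snd (Y \<alpha>))"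
        using c[OF that] N by (simp add: continuous_gts_iff)
      also have "(h \<circ> \<psi> \<alpha>) -` N \<inter> elts (fst (Y \<alpha>))
          = \<psi> \<alpha> -` (h -` N \<inter> elts X) \<inter> elts (fst (Y \<alpha>))"
        using \<psi>[OF that] by auto
      finally show ?thesis .
    qed
    then show "h -` N \<inter> elts (fst (X, \<mu>)) \<in> opens (snd (X, \<mu>))"
      by (auto simp: \<mu> T_def)
  qed
  ultimately show ?thesis
    using gts by (auto simp: final_lift_def)
qed


section \<open>Functors and cones\<close>

lemma cmp_in_hom:
  assumes "is_category C" "f \<in> hom C x y" "g \<in> hom C y z"
  shows "cmp C g f \<in> hom C x z"
  using assms by (auto simp: is_category_def hom_def)

lemma functor_hom:
  assumes "is_functor C D Fo Fa" "f \<in> hom C x y"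
  shows "Fa f \<in> hom D (Fo x) (Fo y)"
  using assms by (auto simp: is_functor_def hom_def)

lemma functor_cmp:
  assumes "is_functor C D Fo Fa" "f \<in> hom C x y" "g \<in> hom C y z"
  shows "Fa (cmp C g f) = cmp D (Fa g) (Fa f)"
  using assms by (auto simp: is_functor_def hom_def)

lemma functor_arr:
  assumes "is_functor J C Do Da" "a \<in> arr J"
  shows "Da a \<in> hom C (Do (src J a)) (Do (tgt J a))" "src J a \<in> obj J" "tgt J a \<in> obj J"
  using assms by (auto simp: is_functor_def is_category_def)

lemma functor_comp:
  assumes "is_functor J C Do Da" "is_functor C D Fo Fa"
  shows "is_functor J D (Fo \<circ> Do) (Fa \<circ> Da)"
  using assms unfolding is_functor_def hom_def by (simp add: is_category_def hom_def)

lemma functor_preserves_cone: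
  assumes D: "is_functor J C Do Da" and F: "is_functor C E Fo Fa"
    and cone: "is_cone J C Do Da L p"
  shows "is_cone J E (Fo \<circ> Do) (Fa \<circ> Da) (Fo L) (Fa \<circ> p)"
proof -
  have "cmp E (Fa (Da a)) (Fa (p (src J a))) = Fa (p (tgt J a))" if "a \<in> arr J" for a
    using functor_arr[OF D that] cone that
      functor_cmp[OF F, of "p (src J a)" L "Do (src J a)" "Da a" "Do (tgt J a)"]
    by (simp add: is_cone_def)
  then show ?thesis
    using cone F functor_hom[OF F] by (auto simp: is_cone_def is_functor_def)
qed

lemma functor_preserves_cocone:
  assumes D: "is_functor J C Do Da" and F: "is_functor C E Fo Fa"
    and cocone: "is_cocone J C Do Da L p"
  shows "is_cocone J E (Fo \<circ> Do) (Fa \<circ> Da) (Fo L) (Fa \<circ> p)"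
proof -
  have "cmp E (Fa (p (tgt J a))) (Fa (Da a)) = Fa (p (src J a))" if "a \<in> arr J" for a
    using functor_arr[OF D that] cocone that
      functor_cmp[OF F, of "Da a" "Do (src J a)" "Do (tgt J a)" "p (tgt J a)" L]
    by (simp add: is_cocone_def)
  then show ?thesis
    using cocone F functor_hom[OF F] by (auto simp: is_cocone_def is_functor_def)
qed


section \<open>The forgetful functor\<close>

lemma hom_SetCat_iff:
  "a \<in> hom SetCat X Y \<longleftrightarrow> (\<exists>f. a = (X, f, Y) \<and> f \<in> elts X \<rightarrow>\<^sub>E elts Y)"
  by (auto simp: hom_def SetCat_def)

lemma hom_GenTop_iff:
  "a \<in> hom GenTop P Q \<longleftrightarrow> (\<exists>f. a = (P, f, Q) \<and> is_gts P \<and> is_gts Q \<and>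
     f \<in> extensional (elts (fst P)) \<and> continuous_gts P Q f)"
  by (auto simp: hom_def GenTop_def)

lemma obj_SetCat [simp]: "obj SetCat = UNIV"
  by (simp add: SetCat_def)

lemma obj_GenTop [simp]: "obj GenTop = {P. is_gts P}"
  by (simp add: GenTop_def)

lemma cmp_SetCat [simp]:
  "cmp SetCat (Y, g, Z) (X, f, Y') = (X, compose (elts X) g f, Z)"
  by (simp add: SetCat_def)

lemma is_category_SetCat: "is_category (SetCat :: ('v::set_universe, 'v set_arr) cat)"
  unfolding is_category_def hom_def
  by (auto simp: SetCat_def compose_def restrict_def extensional_def fun_eq_iff PiE_iff Pi_iff)

lemma is_category_GenTop: "is_category (GenTop :: ('v::set_universe \<times> 'v, 'v gts_arr) cat)"
proof -
  have id: "continuous_gts (X, \<mu>) (X, \<mu>) (\<lambda>x\<in>elts X. x)" if "is_gts (X, \<mu>)" for X \<mu> :: 'v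
    using continuous_gts_id[OF that] continuous_gts_cong[of "(X, \<mu>)" id "\<lambda>x\<in>elts X. x"]
    by simp
  have comp: "continuous_gts (X, \<mu>) R (compose (elts X) g f)"
    if "continuous_gts (X, \<mu>) Q f" "continuous_gts Q R g" 
    for X \<mu> :: 'v and Q R :: "'v \<times> 'v" and f g
    using continuous_gts_comp[OF that]
      continuous_gts_cong[of "(X, \<mu>)" "g \<circ> f" "compose (elts X) g f"]
    by (simp add: compose_def)
  have map: "f \<in> elts X \<rightarrow> elts Y" if "continuous_gts (X, \<mu>) (Y, \<nu>) f"
    for X Y \<mu> \<nu> :: 'v and f
    using that by (simp add: continuous_gts_iff)
  show ?thesis
    unfolding is_category_def hom_def
    by (auto simp: GenTop_def id_def id comp Id_compose[OF map] compose_Id[OF map]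
        compose_assoc[OF map])
qed

lemma is_functor_U:
  "is_functor (GenTop :: ('v::set_universe \<times> 'v, 'v gts_arr) cat) SetCat U_obj U_arr"
proof -
  have map: "f \<in> elts X \<rightarrow>\<^sub>E elts Y"
    if "continuous_gts (X, \<mu>) (Y, \<nu>) f" "f \<in> extensional (elts X)" for X Y \<mu> \<nu> :: 'v and f
    using that by (auto simp: continuous_gts_iff PiE_def)
  show ?thesis
    unfolding is_functor_def hom_def
    using is_category_GenTop is_category_SetCat
    by (auto simp: GenTop_def SetCat_def U_obj_def U_arr_def
        intro: map[THEN PiE_mem] map[THEN PiE_arb])
qed

lemma faithful_U: "faithful (GenTop :: ('v::set_universe \<times> 'v, 'v gts_arr) cat) U_arr"
  by (auto simp: faithful_def inj_on_def hom_GenTop_iff U_arr_def)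

lemma U_arr_inj:
  assumes "f \<in> hom GenTop P Q" "g \<in> hom GenTop P Q" "U_arr f = U_arr g"
  shows "f = g"
  using assms by (auto simp: hom_GenTop_iff U_arr_def)


section \<open>Limits and colimits of sets\<close>

text \<open>The limit of a diagram of sets is the set of its compatible families, that is, of the
  elements of the product that are respected by all maps of the diagram. These are coded as
  elements of the universe.\<close>

lemma SetCat_limit_exists:
  fixes J :: "('v::set_universe, 'v) cat" and Do :: "'v \<Rightarrow> 'v"
  assumes J: "small_category J" and D: "is_functor J SetCat Do Da"
  shows "\<exists>L p. is_limit J SetCat Do Da L p"
proof -
  define t where "t a = arr_fun (Da a)" for a
  have Da: "Da a = (Do (src J a), t a, Do (tgt J a))" if "a \<in> arr J" for a
    using functor_arr(1)[OF D that] by (auto simp: hom_SetCat_iff t_def)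
  note ends = functor_arr(2,3)[OF D]
  define P where "P = (\<Pi>\<^sub>E j\<in>obj J. elts (Do j))"
  define S where "S = {s \<in> P. \<forall>a\<in>arr J. t a (s (src J a)) = s (tgt J a)}"
  have "small (obj J)"
    using J by (simp add: small_category_def small_def)
  then obtain e :: "('v \<Rightarrow> 'v) \<Rightarrow> 'v" where "inj_on e P" "small (e ` P)"
    unfolding P_def by (rule small_PiE_code) auto
  then have e: "inj_on e S" "small (e ` S)"
    by (auto simp: S_def elim!: inj_on_subset small_subset)
  define L where "L = vset (e ` S)"
  have L: "elts L = e ` S"
    using e by (simp add: L_def)
  define \<pi> where "\<pi> j = (\<lambda>x\<in>elts L. inv_into S e x j)" for j
  have \<pi>: "\<pi> j (e s) = s j" if "s \<in> S" for s j
    using that e by (simp add: \<pi>_def L)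
  have S_mem: "s j \<in> elts (Do j)" if "s \<in> S" "j \<in> obj J" for s j
    using that by (auto simp: S_def P_def)
  have "is_limit J SetCat Do Da L (\<lambda>j. (L, \<pi> j, Do j))"
    unfolding is_limit_def
  proof (intro conjI allI impI)
    have "\<pi> j \<in> elts L \<rightarrow>\<^sub>E elts (Do j)" if "j \<in> obj J" for j
      using that S_mem \<pi> by (auto simp: L) (simp add: \<pi>_def L)
    moreover have "compose (elts L) (t a) (\<pi> (src J a)) = \<pi> (tgt J a)" if "a \<in> arr J" for a
    proof (rule extensionalityI[of _ "elts L"])
      fix x assume "x \<in> elts L"
      then obtain s where "s \<in> S" "x = e s"
        by (auto simp: L)
      then show "compose (elts L) (t a) (\<pi> (src J a)) x = \<pi> (tgt J a) x"
        using that by (simp add: compose_def \<pi> L S_def)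
    qed (simp_all add: \<pi>_def)
    ultimately show "is_cone J SetCat Do Da L (\<lambda>j. (L, \<pi> j, Do j))"
      by (auto simp: is_cone_def hom_SetCat_iff Da)
  next
    fix Z q assume cone: "is_cone J SetCat Do Da Z q"
    define g where "g j = arr_fun (q j)" for j
    have q: "q j = (Z, g j, Do j)" "g j \<in> elts Z \<rightarrow>\<^sub>E elts (Do j)" if "j \<in> obj J" for j
      using cone that unfolding is_cone_def hom_SetCat_iff by (force simp: g_def)+
    have "compose (elts Z) (t a) (g (src J a)) = g (tgt J a)" if "a \<in> arr J" for a
      using cone that ends[OF that] by (auto simp: is_cone_def Da q)
    then have comp: "t a (g (src J a) z) = g (tgt J a) z" if "a \<in> arr J" "z \<in> elts Z" for a z
      using that by (metis compose_eq)
    define fam where "fam z = (\<lambda>j\<in>obj J. g j z)" for z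
    have fam: "fam z \<in> S" if "z \<in> elts Z" for z
      using that q(2) comp ends by (auto simp: fam_def S_def P_def)
    show "\<exists>!h. h \<in> hom SetCat Z L \<and> (\<forall>j\<in>obj J. cmp SetCat (L, \<pi> j, Do j) h = q j)"
    proof (rule ex1I)
      let ?h = "(Z, \<lambda>z\<in>elts Z. e (fam z), L)"
      have "compose (elts Z) (\<pi> j) (\<lambda>z\<in>elts Z. e (fam z)) = g j" if "j \<in> obj J" for j
      proof (rule extensionalityI[of _ "elts Z"])
        show "g j \<in> extensional (elts Z)"
          using q(2)[OF that] by (auto simp: PiE_def)
      qed (use that in \<open>simp_all add: compose_def \<pi> fam, simp add: fam_def\<close>)
      then show "?h \<in> hom SetCat Z L \<and> (\<forall>j\<in>obj J. cmp SetCat (L, \<pi> j, Do j) ?h = q j)"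
        using fam by (auto simp: hom_SetCat_iff L q)
      fix h assume h: "h \<in> hom SetCat Z L \<and> (\<forall>j\<in>obj J. cmp SetCat (L, \<pi> j, Do j) h = q j)"
      then obtain k where k: "h = (Z, k, L)" "k \<in> elts Z \<rightarrow>\<^sub>E elts L"
        by (auto simp: hom_SetCat_iff)
      have kg: "\<pi> j (k z) = g j z" if "j \<in> obj J" "z \<in> elts Z" for j z
      proof -
        have "compose (elts Z) (\<pi> j) k = g j"
          using h that by (auto simp: k q)
        then show ?thesis
          using that by (metis compose_eq)
      qed
      have "k z = e (fam z)" if "z \<in> elts Z" for z
      proof -
        have "k z \<in> e ` S"
          using PiE_mem[OF k(2) that] by (simp add: L)
        then obtain s where s: "s \<in> S" "k z = e s"
          by blast
        have "s = fam z"
        proof (rule extensionalityI[of _ "obj J"])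
          show "s \<in> extensional (obj J)"
            using s by (auto simp: S_def P_def PiE_def)
        qed (use kg[OF _ that] s in \<open>auto simp: fam_def \<pi>\<close>)
        with s show ?thesis
          by simp
      qed
      then have "k = (\<lambda>z\<in>elts Z. e (fam z))"
        using k(2) by (intro extensionalityI[of _ "elts Z"]) (auto simp: PiE_def)
      then show "h = ?h"
        by (simp add: k)
    qed
  qed
  then show ?thesis
    by blast
qed

text \<open>The colimit of a diagram of sets is the quotient of its disjoint union by the equivalence
  relation generated by identifying each point with its images under the maps of the diagram.
  Two points are equivalent iff no function compatible with the diagram separates them. Taking
  this as the definition makes every cocone factor through the quotient at once, since a cocone
  is given by such a function on the disjoint union. The quotient map \<open>w\<close> sends a point to the
  code of its equivalence class.\<close>

lemma SetCat_colimit_exists: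
  fixes J :: "('v::set_universe, 'v) cat" and Do :: "'v \<Rightarrow> 'v"
  assumes J: "small_category J" and D: "is_functor J SetCat Do Da"
  shows "\<exists>L p. is_colimit J SetCat Do Da L p"
proof -
  define t where "t a = arr_fun (Da a)" for a
  have Da: "Da a = (Do (src J a), t a, Do (tgt J a))"
    and t: "t a \<in> elts (Do (src J a)) \<rightarrow>\<^sub>E elts (Do (tgt J a))" if "a \<in> arr J" for a
    using functor_arr(1)[OF D that] by (auto simp: hom_SetCat_iff t_def)
  note ends = functor_arr(2,3)[OF D]
  define M where "M = Sigma (obj J) (\<lambda>j. elts (Do j))"
  define compatible :: "('v \<times> 'v \<Rightarrow> 'v) \<Rightarrow> bool" where
    "compatible f \<longleftrightarrow>
       (\<forall>a\<in>arr J. \<forall>x\<in>elts (Do (src J a)). f (tgt J a, t a x) = f (src J a, x))" for f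
  define cls where "cls m = {m' \<in> M. \<forall>f. compatible f \<longrightarrow> f m = f m'}" for m
  have cls_eq: "cls m = cls m' \<longleftrightarrow> (\<forall>f. compatible f \<longrightarrow> f m = f m')"
    if "m \<in> M" "m' \<in> M" for m m'
  proof
    assume "cls m = cls m'"
    moreover have "m' \<in> cls m'"
      using that by (simp add: cls_def)
    ultimately show "\<forall>f. compatible f \<longrightarrow> f m = f m'"
      by (auto simp: cls_def)
  next
    assume "\<forall>f. compatible f \<longrightarrow> f m = f m'"
    then show "cls m = cls m'"
      unfolding cls_def by (intro Collect_cong) metis
  qed
  have "small (obj J)"
    using J by (simp add: small_category_def small_def)
  then have "small (case_prod kpair ` M)"
    unfolding M_def by (rule small_Sigma_code) auto
  moreover have "inj_on (case_prod kpair) M"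
    by (auto simp: inj_on_def)
  ultimately obtain e :: "('v \<times> 'v) set \<Rightarrow> 'v" where e: "inj_on e (Pow M)" "small (e ` Pow M)"
    using small_Pow_code by blast
  define w where "w m = e (cls m)" for m
  have cls_sub: "cls m \<in> Pow M" for m
    by (auto simp: cls_def)
  have w_eq: "w m = w m' \<longleftrightarrow> (\<forall>f. compatible f \<longrightarrow> f m = f m')" if "m \<in> M" "m' \<in> M" for m m'
    using e(1) cls_sub cls_eq[OF that] by (auto simp: w_def inj_on_eq_iff)
  have "small (w ` M)"
    using e(2) by (rule small_subset) (use cls_sub in \<open>auto simp: w_def\<close>)
  define L where "L = vset (w ` M)"
  have L: "elts L = w ` M"
    using \<open>small (w ` M)\<close> by (simp add: L_def)
  define \<iota> where "\<iota> j = (\<lambda>x\<in>elts (Do j). w (j, x))" for j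
  have "is_colimit J SetCat Do Da L (\<lambda>j. (Do j, \<iota> j, L))"
    unfolding is_colimit_def
  proof (intro conjI allI impI)
    have "\<iota> j \<in> elts (Do j) \<rightarrow>\<^sub>E elts L" if "j \<in> obj J" for j
      using that by (auto simp: \<iota>_def L M_def)
    moreover have "compose (elts (Do (src J a))) (\<iota> (tgt J a)) (t a) = \<iota> (src J a)"
      if "a \<in> arr J" for a
    proof (rule extensionalityI[of _ "elts (Do (src J a))"])
      fix x assume x: "x \<in> elts (Do (src J a))"
      then have tx: "t a x \<in> elts (Do (tgt J a))"
        using t[OF that] by auto
      have "w (tgt J a, t a x) = w (src J a, x)"
        using x tx ends[OF that] that by (subst w_eq) (auto simp: M_def compatible_def)
      then show "compose (elts (Do (src J a))) (\<iota> (tgt J a)) (t a) x = \<iota> (src J a) x"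
        using x tx by (simp add: compose_def \<iota>_def)
    qed (simp_all add: \<iota>_def)
    ultimately show "is_cocone J SetCat Do Da L (\<lambda>j. (Do j, \<iota> j, L))"
      by (auto simp: is_cocone_def hom_SetCat_iff Da)
  next
    fix Z q assume cocone: "is_cocone J SetCat Do Da Z q"
    define g where "g j = arr_fun (q j)" for j
    have q: "q j = (Do j, g j, Z)" "g j \<in> elts (Do j) \<rightarrow>\<^sub>E elts Z" if "j \<in> obj J" for j
      using cocone that unfolding is_cocone_def hom_SetCat_iff by (force simp: g_def)+
    have "compose (elts (Do (src J a))) (g (tgt J a)) (t a) = g (src J a)" if "a \<in> arr J" for a
      using cocone that ends[OF that] by (auto simp: is_cocone_def Da q)
    then have "compatible (\<lambda>(j, x). g j x)"
      unfolding compatible_def by (metis (no_types, lifting) case_prod_conv compose_eq)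
    then have const: "g i x = g j y"
      if "(i, x) \<in> M" "(j, y) \<in> M" "w (i, x) = w (j, y)" for i x j y
      using w_eq[OF that(1,2)] that(3) by (metis (no_types, lifting) case_prod_conv)
    \<comment> \<open>The value at a class is read off at an arbitrary representative, which \<open>const\<close> justifies.\<close>
    define k where "k = (\<lambda>y\<in>elts L. case_prod g (inv_into M w y))"
    have k: "k (w (j, x)) = g j x" if "(j, x) \<in> M" for j x
    proof -
      obtain i y where iy: "inv_into M w (w (j, x)) = (i, y)"
        by fastforce
      have "w (i, y) = w (j, x)" "(i, y) \<in> M"
        using that iy f_inv_into_f[of "w (j, x)" w M] inv_into_into[of "w (j, x)" w M] by auto
      then show ?thesis
        using that const[of i y j x] iy by (simp add: k_def L)
    qed
    show "\<exists>!h. h \<in> hom SetCat L Z \<and> (\<forall>j\<in>obj J. cmp SetCat h (Do j, \<iota> j, L) = q j)"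
    proof (rule ex1I)
      have "k \<in> elts L \<rightarrow>\<^sub>E elts Z"
      proof (rule PiE_I)
        fix y assume "y \<in> elts L"
        then obtain j x where "(j, x) \<in> M" "y = w (j, x)"
          by (auto simp: L)
        then show "k y \<in> elts Z"
          using k q(2) by (auto simp: M_def)
      qed (simp add: k_def)
      moreover have "compose (elts (Do j)) k (\<iota> j) = g j" if "j \<in> obj J" for j
      proof (rule extensionalityI[of _ "elts (Do j)"])
        show "g j \<in> extensional (elts (Do j))"
          using q(2)[OF that] by (auto simp: PiE_def)
      qed (use that in \<open>simp_all add: compose_def \<iota>_def k M_def\<close>)
      ultimately show "(L, k, Z) \<in> hom SetCat L Z \<and>
          (\<forall>j\<in>obj J. cmp SetCat (L, k, Z) (Do j, \<iota> j, L) = q j)"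
        by (auto simp: hom_SetCat_iff q)
      fix h assume h: "h \<in> hom SetCat L Z \<and> (\<forall>j\<in>obj J. cmp SetCat h (Do j, \<iota> j, L) = q j)"
      then obtain l where l: "h = (L, l, Z)" "l \<in> elts L \<rightarrow>\<^sub>E elts Z"
        by (auto simp: hom_SetCat_iff)
      have "l (w (j, x)) = g j x" if "(j, x) \<in> M" for j x
      proof -
        have "j \<in> obj J" "x \<in> elts (Do j)"
          using that by (auto simp: M_def)
        then have "compose (elts (Do j)) l (\<iota> j) = g j"
          using h by (auto simp: l q)
        then have "l (\<iota> j x) = g j x"
          using \<open>x \<in> elts (Do j)\<close> by (metis compose_eq)
        then show ?thesis
          using \<open>x \<in> elts (Do j)\<close> by (simp add: \<iota>_def)
      qed
      then have "l = k"
        using l(2) k by (intro extensionalityI[of _ "elts L"]) (auto simp: PiE_def L k_def)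
      then show "h = (L, k, Z)"
        by (simp add: l)
    qed
  qed
  then show ?thesis
    by blast
qed


section \<open>Lifting limits and colimits\<close>

text \<open>The mediating map of sets is continuous for the initial lift because its composites with
  the projections are the given continuous maps; all equations hold since \<open>U\<close> is faithful.\<close>

lemma initial_lift_is_limit:
  assumes D: "is_functor J GenTop Do Da"
    and lim: "is_limit J SetCat (U_obj \<circ> Do) (U_arr \<circ> Da) L p"
    and init: "initial_lift L (obj J) Do (\<lambda>j. arr_fun (p j)) \<mu>"
  shows "is_limit J GenTop Do Da (L, \<mu>) (\<lambda>j. ((L, \<mu>), arr_fun (p j), Do j))"
proof -
  define p' where "p' j = ((L, \<mu>), arr_fun (p j), Do j)" for j
  have Do: "is_gts (Do j)" if "j \<in> obj J" for j
    using D that by (auto simp: is_functor_def)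
  have cone: "is_cone J SetCat (U_obj \<circ> Do) (U_arr \<circ> Da) L p"
    using lim by (simp add: is_limit_def)
  have p: "p j = (L, arr_fun (p j), fst (Do j))" "arr_fun (p j) \<in> elts L \<rightarrow>\<^sub>E elts (fst (Do j))"
    if "j \<in> obj J" for j
    using cone that unfolding is_cone_def hom_SetCat_iff by (force simp: U_obj_def)+
  have Up': "U_arr (p' j) = p j" if "j \<in> obj J" for j
    using p(1)[OF that] by (simp add: p'_def U_arr_def U_obj_def)
  have p': "p' j \<in> hom GenTop (L, \<mu>) (Do j)" if "j \<in> obj J" for j
    using that init p(2)[OF that] Do[OF that]
    by (auto simp: p'_def hom_GenTop_iff initial_lift_def PiE_def)
  have eq: "cmp GenTop (Da a) (p' (src J a)) = p' (tgt J a)" if "a \<in> arr J" for a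
  proof (rule U_arr_inj)
    note a = functor_arr[OF D that]
    show "cmp GenTop (Da a) (p' (src J a)) \<in> hom GenTop (L, \<mu>) (Do (tgt J a))"
      by (rule cmp_in_hom[OF is_category_GenTop p' a(1)]) (rule a)
    show "p' (tgt J a) \<in> hom GenTop (L, \<mu>) (Do (tgt J a))"
      by (rule p') (rule a)
    show "U_arr (cmp GenTop (Da a) (p' (src J a))) = U_arr (p' (tgt J a))"
      using cone that functor_cmp[OF is_functor_U p'[OF a(2)] a(1)] a
      by (simp add: Up' is_cone_def)
  qed
  have "is_limit J GenTop Do Da (L, \<mu>) p'"
    unfolding is_limit_def
  proof (intro conjI allI impI)
    show "is_cone J GenTop Do Da (L, \<mu>) p'"
      using init p' eq by (auto simp: is_cone_def initial_lift_def)
    fix Z q assume cone_q: "is_cone J GenTop Do Da Z q"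
    have Z: "is_gts Z" and q: "\<And>j. j \<in> obj J \<Longrightarrow> q j \<in> hom GenTop Z (Do j)"
      using cone_q by (auto simp: is_cone_def)
    obtain k where k: "k \<in> hom SetCat (U_obj Z) L"
        "\<And>j. j \<in> obj J \<Longrightarrow> cmp SetCat (p j) k = U_arr (q j)"
      and k_unique: "\<And>k'. k' \<in> hom SetCat (U_obj Z) L \<Longrightarrow>
        (\<forall>j\<in>obj J. cmp SetCat (p j) k' = U_arr (q j)) \<Longrightarrow> k' = k"
      using functor_preserves_cone[OF D is_functor_U cone_q] lim
      unfolding is_limit_def comp_def by (metis (no_types, lifting))
    obtain f where f: "k = (fst Z, f, L)" "f \<in> elts (fst Z) \<rightarrow>\<^sub>E elts L"
      using k(1) by (auto simp: hom_SetCat_iff U_obj_def)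
    define h where "h = (Z, f, (L, \<mu>))"
    have Uh: "U_arr h = k"
      by (simp add: h_def f U_arr_def U_obj_def)
    have "continuous_gts Z (Do j) (arr_fun (p j) \<circ> f)" if j: "j \<in> obj J" for j
    proof -
      obtain g where g: "q j = (Z, g, Do j)" "continuous_gts Z (Do j) g"
        using q[OF j] by (auto simp: hom_GenTop_iff)
      have "cmp SetCat (p j) k = (fst Z, compose (elts (fst Z)) (arr_fun (p j)) f, fst (Do j))"
        by (subst p(1)[OF j]) (simp add: f(1))
      then have "compose (elts (fst Z)) (arr_fun (p j)) f = g"
        using k(2)[OF j] by (simp add: g(1) U_arr_def)
      then have "(arr_fun (p j) \<circ> f) x = g x" if "x \<in> elts (fst Z)" for x
        using that by (metis comp_apply compose_eq)
      then show ?thesis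
        using g(2) continuous_gts_cong[of Z "arr_fun (p j) \<circ> f" g "Do j"] by blast
    qed
    then have "continuous_gts Z (L, \<mu>) f"
      using init Z f(2) unfolding initial_lift_def PiE_def by blast
    then have h: "h \<in> hom GenTop Z (L, \<mu>)"
      using Z init f(2) by (auto simp: h_def hom_GenTop_iff initial_lift_def PiE_def)
    show "\<exists>!h. h \<in> hom GenTop Z (L, \<mu>) \<and> (\<forall>j\<in>obj J. cmp GenTop (p' j) h = q j)"
    proof (rule ex1I)
      have "cmp GenTop (p' j) h = q j" if j: "j \<in> obj J" for j
      proof (rule U_arr_inj)
        show "cmp GenTop (p' j) h \<in> hom GenTop Z (Do j)"
          by (rule cmp_in_hom[OF is_category_GenTop h p'[OF j]])
        show "U_arr (cmp GenTop (p' j) h) = U_arr (q j)"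
          using functor_cmp[OF is_functor_U h p'[OF j]] j k(2) by (simp add: Up' Uh)
      qed (rule q[OF j])
      with h show "h \<in> hom GenTop Z (L, \<mu>) \<and> (\<forall>j\<in>obj J. cmp GenTop (p' j) h = q j)"
        by blast
      fix h' assume h': "h' \<in> hom GenTop Z (L, \<mu>) \<and> (\<forall>j\<in>obj J. cmp GenTop (p' j) h' = q j)"
      have "U_arr h' = k"
      proof (rule k_unique)
        show "U_arr h' \<in> hom SetCat (U_obj Z) L"
          using functor_hom[OF is_functor_U, of h' Z "(L, \<mu>)"] h' by (simp add: U_obj_def)
        show "\<forall>j\<in>obj J. cmp SetCat (p j) (U_arr h') = U_arr (q j)"
          using h' functor_cmp[OF is_functor_U _ p', of h' Z] by (auto simp: Up')
      qed
      then show "h' = h"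
        using U_arr_inj h h' Uh by metis
    qed
  qed
  then show ?thesis
    by (simp add: p'_def[abs_def])
qed

text \<open>Dually, the mediating map of sets is continuous for the final lift because its composites
  with the injections are the given continuous maps.\<close>

lemma final_lift_is_colimit:
  assumes D: "is_functor J GenTop Do Da"
    and colim: "is_colimit J SetCat (U_obj \<circ> Do) (U_arr \<circ> Da) L p"
    and final: "final_lift L (obj J) Do (\<lambda>j. arr_fun (p j)) \<mu>"
  shows "is_colimit J GenTop Do Da (L, \<mu>) (\<lambda>j. (Do j, arr_fun (p j), (L, \<mu>)))"
proof -
  define p' where "p' j = (Do j, arr_fun (p j), (L, \<mu>))" for j
  have Do: "is_gts (Do j)" if "j \<in> obj J" for j
    using D that by (auto simp: is_functor_def)
  have cocone: "is_cocone J SetCat (U_obj \<circ> Do) (U_arr \<circ> Da) L p"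
    using colim by (simp add: is_colimit_def)
  have p: "p j = (fst (Do j), arr_fun (p j), L)" "arr_fun (p j) \<in> elts (fst (Do j)) \<rightarrow>\<^sub>E elts L"
    if "j \<in> obj J" for j
    using cocone that unfolding is_cocone_def hom_SetCat_iff by (force simp: U_obj_def)+
  have Up': "U_arr (p' j) = p j" if "j \<in> obj J" for j
    using p(1)[OF that] by (simp add: p'_def U_arr_def U_obj_def)
  have p': "p' j \<in> hom GenTop (Do j) (L, \<mu>)" if "j \<in> obj J" for j
    using that final p(2)[OF that] Do[OF that]
    by (auto simp: p'_def hom_GenTop_iff final_lift_def PiE_def)
  have eq: "cmp GenTop (p' (tgt J a)) (Da a) = p' (src J a)" if "a \<in> arr J" for a
  proof (rule U_arr_inj)
    note a = functor_arr[OF D that]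
    show "cmp GenTop (p' (tgt J a)) (Da a) \<in> hom GenTop (Do (src J a)) (L, \<mu>)"
      by (rule cmp_in_hom[OF is_category_GenTop a(1) p']) (rule a)
    show "p' (src J a) \<in> hom GenTop (Do (src J a)) (L, \<mu>)"
      by (rule p') (rule a)
    show "U_arr (cmp GenTop (p' (tgt J a)) (Da a)) = U_arr (p' (src J a))"
      using cocone that functor_cmp[OF is_functor_U a(1) p'[OF a(3)]] a
      by (simp add: Up' is_cocone_def)
  qed
  have "is_colimit J GenTop Do Da (L, \<mu>) p'"
    unfolding is_colimit_def
  proof (intro conjI allI impI)
    show "is_cocone J GenTop Do Da (L, \<mu>) p'"
      using final p' eq by (auto simp: is_cocone_def final_lift_def)
    fix Z q assume cocone_q: "is_cocone J GenTop Do Da Z q"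
    have Z: "is_gts Z" and q: "\<And>j. j \<in> obj J \<Longrightarrow> q j \<in> hom GenTop (Do j) Z"
      using cocone_q by (auto simp: is_cocone_def)
    obtain k where k: "k \<in> hom SetCat L (U_obj Z)"
        "\<And>j. j \<in> obj J \<Longrightarrow> cmp SetCat k (p j) = U_arr (q j)"
      and k_unique: "\<And>k'. k' \<in> hom SetCat L (U_obj Z) \<Longrightarrow>
        (\<forall>j\<in>obj J. cmp SetCat k' (p j) = U_arr (q j)) \<Longrightarrow> k' = k"
      using functor_preserves_cocone[OF D is_functor_U cocone_q] colim
      unfolding is_colimit_def comp_def by (metis (no_types, lifting))
    obtain f where f: "k = (L, f, fst Z)" "f \<in> elts L \<rightarrow>\<^sub>E elts (fst Z)"
      using k(1) by (auto simp: hom_SetCat_iff U_obj_def)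
    define h where "h = ((L, \<mu>), f, Z)"
    have Uh: "U_arr h = k"
      by (simp add: h_def f U_arr_def U_obj_def)
    have "continuous_gts (Do j) Z (f \<circ> arr_fun (p j))" if j: "j \<in> obj J" for j
    proof -
      obtain g where g: "q j = (Do j, g, Z)" "continuous_gts (Do j) Z g"
        using q[OF j] by (auto simp: hom_GenTop_iff)
      have "cmp SetCat k (p j) = (fst (Do j), compose (elts (fst (Do j))) f (arr_fun (p j)), fst Z)"
        by (subst p(1)[OF j]) (simp add: f(1))
      then have "compose (elts (fst (Do j))) f (arr_fun (p j)) = g"
        using k(2)[OF j] by (simp add: g(1) U_arr_def)
      then have "(f \<circ> arr_fun (p j)) x = g x" if "x \<in> elts (fst (Do j))" for x
        using that by (metis comp_apply compose_eq)
      then show ?thesis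
        using g(2) continuous_gts_cong[of "Do j" "f \<circ> arr_fun (p j)" g Z] by blast
    qed
    then have "continuous_gts (L, \<mu>) Z f"
      using final Z f(2) unfolding final_lift_def PiE_def by blast
    then have h: "h \<in> hom GenTop (L, \<mu>) Z"
      using Z final f(2) by (auto simp: h_def hom_GenTop_iff final_lift_def PiE_def)
    show "\<exists>!h. h \<in> hom GenTop (L, \<mu>) Z \<and> (\<forall>j\<in>obj J. cmp GenTop h (p' j) = q j)"
    proof (rule ex1I)
      have "cmp GenTop h (p' j) = q j" if j: "j \<in> obj J" for j
      proof (rule U_arr_inj)
        show "cmp GenTop h (p' j) \<in> hom GenTop (Do j) Z"
          by (rule cmp_in_hom[OF is_category_GenTop p'[OF j] h])
        show "U_arr (cmp GenTop h (p' j)) = U_arr (q j)"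
          using functor_cmp[OF is_functor_U p'[OF j] h] j k(2) by (simp add: Up' Uh)
      qed (rule q[OF j])
      with h show "h \<in> hom GenTop (L, \<mu>) Z \<and> (\<forall>j\<in>obj J. cmp GenTop h (p' j) = q j)"
        by blast
      fix h' assume h': "h' \<in> hom GenTop (L, \<mu>) Z \<and> (\<forall>j\<in>obj J. cmp GenTop h' (p' j) = q j)"
      have "U_arr h' = k"
      proof (rule k_unique)
        show "U_arr h' \<in> hom SetCat L (U_obj Z)"
          using functor_hom[OF is_functor_U, of h' "(L, \<mu>)" Z] h' by (simp add: U_obj_def)
        show "\<forall>j\<in>obj J. cmp SetCat (U_arr h') (p j) = U_arr (q j)"
          using h' functor_cmp[OF is_functor_U p', of _ h' Z] by (auto simp: Up')
      qed
      then show "h' = h"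
        using U_arr_inj h h' Uh by metis
    qed
  qed
  then show ?thesis
    by (simp add: p'_def[abs_def])
qed

lemma limit_initial_lift_exists:
  assumes D: "is_functor J GenTop Do Da"
    and lim: "is_limit J SetCat (U_obj \<circ> Do) (U_arr \<circ> Da) L p"
  shows "\<exists>\<mu>. initial_lift L (obj J) Do (\<lambda>j. arr_fun (p j)) \<mu>"
proof (rule initial_lift_exists)
  fix j assume "j \<in> obj J"
  then show "is_gts (Do j)" "arr_fun (p j) \<in> elts L \<rightarrow> elts (fst (Do j))"
    using D lim unfolding is_functor_def is_limit_def is_cone_def hom_SetCat_iff
    by (force simp: U_obj_def)+
qed

lemma colimit_final_lift_exists:
  assumes D: "is_functor J GenTop Do Da"
    and colim: "is_colimit J SetCat (U_obj \<circ> Do) (U_arr \<circ> Da) L p"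
  shows "\<exists>\<mu>. final_lift L (obj J) Do (\<lambda>j. arr_fun (p j)) \<mu>"
proof (rule final_lift_exists)
  fix j assume "j \<in> obj J"
  then show "is_gts (Do j)" "arr_fun (p j) \<in> elts (fst (Do j)) \<rightarrow> elts L"
    using D colim unfolding is_functor_def is_colimit_def is_cocone_def hom_SetCat_iff
    by (force simp: U_obj_def)+
qed


section \<open>The category of generalized topological spaces is topological over sets\<close>

theorem theorem3p1:
  shows
    "is_functor (GenTop :: ('v::set_universe \<times> 'v, 'v gts_arr) cat) SetCat U_obj U_arr
     \<and> faithful (GenTop :: ('v \<times> 'v, 'v gts_arr) cat) U_arr
     \<and> (\<forall>X \<mu> \<nu> :: 'v. is_gts (X, \<mu>) \<longrightarrow> is_gts (X, \<nu>) \<longrightarrow>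
          continuous_gts (X, \<mu>) (X, \<nu>) id \<longrightarrow> continuous_gts (X, \<nu>) (X, \<mu>) id \<longrightarrow> \<mu> = \<nu>)
     \<and> (\<forall>X :: 'v. {\<mu>. is_gts (X, \<mu>)} \<in> range elts)
     \<and> (\<forall>(X :: 'v) (J :: 'v set) Y \<phi>.
          (\<forall>\<alpha>\<in>J. is_gts (Y \<alpha>) \<and> \<phi> \<alpha> \<in> elts X \<rightarrow> elts (U_obj (Y \<alpha>))) \<longrightarrow>
          (\<exists>\<mu>. initial_lift X J Y \<phi> \<mu>))
     \<and> (\<forall>(X :: 'v) (J :: 'v set) Y \<psi>.
          (\<forall>\<alpha>\<in>J. is_gts (Y \<alpha>) \<and> \<psi> \<alpha> \<in> elts (U_obj (Y \<alpha>)) \<rightarrow> elts X) \<longrightarrow>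
          (\<exists>\<mu>. final_lift X J Y \<psi> \<mu>))
     \<and> (\<forall>(J :: ('v, 'v) cat) (Do :: 'v \<Rightarrow> 'v \<times> 'v) (Da :: 'v \<Rightarrow> 'v gts_arr).
          small_diagram J GenTop Do Da \<longrightarrow>
          (\<exists>L p. is_limit J GenTop Do Da L p) \<and>
          (\<exists>L p. is_limit J SetCat (U_obj \<circ> Do) (U_arr \<circ> Da) L p) \<and>
          (\<forall>L p. is_limit J SetCat (U_obj \<circ> Do) (U_arr \<circ> Da) L p \<longrightarrow>
             (\<exists>\<mu>. initial_lift L (obj J) Do (\<lambda>j. arr_fun (p j)) \<mu>) \<and>
             (\<forall>\<mu>. initial_lift L (obj J) Do (\<lambda>j. arr_fun (p j)) \<mu> \<longrightarrow>
                is_limit J GenTop Do Da (L, \<mu>) (\<lambda>j. ((L, \<mu>), arr_fun (p j), Do j)))))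
     \<and> (\<forall>(J :: ('v, 'v) cat) (Do :: 'v \<Rightarrow> 'v \<times> 'v) (Da :: 'v \<Rightarrow> 'v gts_arr).
          small_diagram J GenTop Do Da \<longrightarrow>
          (\<exists>L p. is_colimit J GenTop Do Da L p) \<and>
          (\<exists>L p. is_colimit J SetCat (U_obj \<circ> Do) (U_arr \<circ> Da) L p) \<and>
          (\<forall>L p. is_colimit J SetCat (U_obj \<circ> Do) (U_arr \<circ> Da) L p \<longrightarrow>
             (\<exists>\<mu>. final_lift L (obj J) Do (\<lambda>j. arr_fun (p j)) \<mu>) \<and>
             (\<forall>\<mu>. final_lift L (obj J) Do (\<lambda>j. arr_fun (p j)) \<mu> \<longrightarrow>
                is_colimit J GenTop Do Da (L, \<mu>) (\<lambda>j. (Do j, arr_fun (p j), (L, \<mu>))))))"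
proof (intro conjI allI impI)
  show "is_functor (GenTop :: ('v \<times> 'v, 'v gts_arr) cat) SetCat U_obj U_arr"
    by (rule is_functor_U)
  show "faithful (GenTop :: ('v \<times> 'v, 'v gts_arr) cat) U_arr"
    by (rule faithful_U)
next
  fix X \<mu> \<nu> :: 'v
  assume "is_gts (X, \<mu>)" "is_gts (X, \<nu>)"
    "continuous_gts (X, \<mu>) (X, \<nu>) id" "continuous_gts (X, \<nu>) (X, \<mu>) id"
  then have "opens \<mu> = opens \<nu>"
    by (intro equalityI) (rule opens_subset_if_id_continuous; assumption)+
  then show "\<mu> = \<nu>"
    by (simp add: opens_eq_iff)
next
  fix X :: 'v
  show "{\<mu>. is_gts (X, \<mu>)} \<in> range elts"
    using small_fibre by (simp add: small_def)
next
  fix X :: 'v and J :: "'v set" and Y :: "'v \<Rightarrow> 'v \<times> 'v" and \<phi>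
  assume "\<forall>\<alpha>\<in>J. is_gts (Y \<alpha>) \<and> \<phi> \<alpha> \<in> elts X \<rightarrow> elts (U_obj (Y \<alpha>))"
  then show "\<exists>\<mu>. initial_lift X J Y \<phi> \<mu>"
    by (intro initial_lift_exists) (simp_all add: U_obj_def)
next
  fix X :: 'v and J :: "'v set" and Y :: "'v \<Rightarrow> 'v \<times> 'v" and \<psi>
  assume "\<forall>\<alpha>\<in>J. is_gts (Y \<alpha>) \<and> \<psi> \<alpha> \<in> elts (U_obj (Y \<alpha>)) \<rightarrow> elts X"
  then show "\<exists>\<mu>. final_lift X J Y \<psi> \<mu>"
    by (intro final_lift_exists) (simp_all add: U_obj_def)
next
  fix J :: "('v, 'v) cat" and Do :: "'v \<Rightarrow> 'v \<times> 'v" and Da :: "'v \<Rightarrow> 'v gts_arr"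
  assume "small_diagram J GenTop Do Da"
  then have J: "small_category J" and D: "is_functor J GenTop Do Da"
    by (simp_all add: small_diagram_def)
  show lim: "\<exists>L p. is_limit J SetCat (U_obj \<circ> Do) (U_arr \<circ> Da) L p"
    by (rule SetCat_limit_exists[OF J functor_comp[OF D is_functor_U]])
  show "\<exists>L p. is_limit J GenTop Do Da L p"
    using lim limit_initial_lift_exists[OF D] initial_lift_is_limit[OF D] by blast
  fix L p assume L: "is_limit J SetCat (U_obj \<circ> Do) (U_arr \<circ> Da) L p"
  show "\<exists>\<mu>. initial_lift L (obj J) Do (\<lambda>j. arr_fun (p j)) \<mu>"
    by (rule limit_initial_lift_exists[OF D L])
  fix \<mu> assume "initial_lift L (obj J) Do (\<lambda>j. arr_fun (p j)) \<mu>"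
  then show "is_limit J GenTop Do Da (L, \<mu>) (\<lambda>j. ((L, \<mu>), arr_fun (p j), Do j))"
    by (rule initial_lift_is_limit[OF D L])
next
  fix J :: "('v, 'v) cat" and Do :: "'v \<Rightarrow> 'v \<times> 'v" and Da :: "'v \<Rightarrow> 'v gts_arr"
  assume "small_diagram J GenTop Do Da"
  then have J: "small_category J" and D: "is_functor J GenTop Do Da"
    by (simp_all add: small_diagram_def)
  show colim: "\<exists>L p. is_colimit J SetCat (U_obj \<circ> Do) (U_arr \<circ> Da) L p"
    by (rule SetCat_colimit_exists[OF J functor_comp[OF D is_functor_U]])
  show "\<exists>L p. is_colimit J GenTop Do Da L p"
    using colim colimit_final_lift_exists[OF D] final_lift_is_colimit[OF D] by blast
  fix L p assume L: "is_colimit J SetCat (U_obj \<circ> Do) (U_arr \<circ> Da) L p"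
  show "\<exists>\<mu>. final_lift L (obj J) Do (\<lambda>j. arr_fun (p j)) \<mu>"
    by (rule colimit_final_lift_exists[OF D L])
  fix \<mu> assume "final_lift L (obj J) Do (\<lambda>j. arr_fun (p j)) \<mu>"
  then show "is_colimit J GenTop Do Da (L, \<mu>) (\<lambda>j. (Do j, arr_fun (p j), (L, \<mu>)))"
    by (rule final_lift_is_colimit[OF D L])
qed

end
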